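(* Let $X = X^0 = (X_1,\ldots,X_n)$ be jointly distributed random variables taking values in finite sets, and let $r\ge 1$. Suppose that for each $k=1,\ldots,r$, a tuple $X^k$ of $n+k$ finite-valued random variables is constructed from the tuple $X^{k-1}$ of $n+k-1$ random variables, whose components we write as $X^{k-1} = (Z_1,\ldots,Z_{n+k-1})$, as follows: $Y_k$ is a (deterministic) function of $X^{k-1}$ with values in a finite set, and $X^k = (\bar Z_1,\ldots,\bar Z_{n+k-1}, Y_k)$, where $(\bar Z_1,\ldots,\bar Z_{n+k-1})$ is perfect remainder information for $X^{k-1}$ with respect to $Y_k$. Then $$TC(X) = TC(X^r) + \sum_{k=1}^r TC(X^{k-1};Y_k).$$
   Context: All random variables are discrete with finite domains. $H(\cdot)$, $H(\cdot|\cdot)$ and $I(\cdot;\cdot)$ denote Shannon entropy, conditional entropy and mutual information (base-two logarithms). For a tuple of random variables $Z=(Z_1,\ldots,Z_m)$, the total correlation is $TC(Z) = \sum_{j=1}^m H(Z_j) - H(Z)$. For a further random variable $W$, $TC(Z|W) = \sum_{j=1}^m H(Z_j|W) - H(Z|W)$ and $$TC(Z;W) = TC(Z) - TC(Z|W) = \sum_{j=1}^m I(Z_j;W) - I(Z;W).$$ Perfect remainder information: given a tuple $Z=(Z_1,\ldots,Z_m)$ and a deterministic function $Y$ of $Z$, random variables $\bar Z_1,\ldots,\bar Z_m$ are perfect remainder information for $Z$ with respect to $Y$ if each $\bar Z_j$ is a probabilistic function of $(Z_j,Y)$, generated independently of the others given $(Z,Y)$, i.e. $p(z,y,\bar z_1,\ldots,\bar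 z_m) = p(z)\,p(y|z)\prod_{j=1}^m p(\bar z_j|z_j,y)$, and for every $j$: (i) $I(\bar Z_j;Y)=0$, and (ii) $H(Z_j|\bar Z_j,Y)=0$. In the paper's notation, $X^1=(X^1_1,\ldots,X^1_n,Y_1)$, $X^2=(X^2_1,\ldots,X^2_n,Y_1^2,Y_2)$, and in general $X^k=(X^k_1,\ldots,X^k_n,Y^k_1,\ldots,Y^k_{k-1},Y_k)$, where $X_i^k$ is the remainder of $X_i^{k-1}$, $Y_j^k$ is the remainder of $Y_j^{k-1}$ for $j<k-1$, and $Y_{k-1}^k$ is the remainder of $Y_{k-1}$. Thus the learned factor $Y_{k-1}$ is included in $X^{k-1}$ and is itself replaced by its remainder at the next layer. *)

theory Defs
  imports "HOL-Probability.Probability"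
begin

text \<open>
  Random variables live on one probability space \<open>M\<close>; finite-valued means \<^const>\<open>simple_function\<close>.
  All quantities are measured in bits. They are the base-two instances of the notions
  \<open>\<H>(X)\<close>, \<open>\<H>(X | Y)\<close> and \<open>\<I>(X ; Y)\<close> of the locale \<^locale>\<open>information_space\<close>.
\<close>

definition entropy_bits :: "'a measure \<Rightarrow> ('a \<Rightarrow> 'b) \<Rightarrow> real" where
  "entropy_bits M X = prob_space.entropy M 2 (count_space (X ` space M)) X"

definition cond_entropy_bits :: "'a measure \<Rightarrow> ('a \<Rightarrow> 'b) \<Rightarrow> ('a \<Rightarrow> 'c) \<Rightarrow> real" where
  "cond_entropy_bits M X Y =
     prob_space.conditional_entropy M 2 (count_space (X ` space M)) (count_space (Y ` space M)) X Y"

definition mutual_info_bits :: "'a measure \<Rightarrow> ('a \<Rightarrow> 'b) \<Rightarrow> ('a \<Rightarrow> 'c) \<Rightarrow> real" where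
  "mutual_info_bits M X Y =
     prob_space.mutual_information M 2 (count_space (X ` space M)) (count_space (Y ` space M)) X Y"

text \<open>
  A tuple \<open>(Z\<^sub>1, \<dots>, Z\<^sub>m)\<close> is a sequence \<open>Z\<close> of random variables together with its length \<open>m\<close>;
  only the entries with index in \<open>{1..m}\<close> are meaningful. Its value is a function that is
  \<^const>\<open>undefined\<close> outside \<open>{1..m}\<close>. The components share a value type, of which each
  of them may use a different finite subset.
\<close>

definition joint :: "nat \<Rightarrow> (nat \<Rightarrow> 'a \<Rightarrow> 'v) \<Rightarrow> 'a \<Rightarrow> (nat \<Rightarrow> 'v)" where
  "joint m Z \<omega> = (\<lambda>j\<in>{1..m}. Z j \<omega>)"

definition total_corr :: "'a measure \<Rightarrow> nat \<Rightarrow> (nat \<Rightarrow> 'a \<Rightarrow> 'v) \<Rightarrow> real" where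
  "total_corr M m Z = (\<Sum>j=1..m. entropy_bits M (Z j)) - entropy_bits M (joint m Z)"

definition cond_total_corr ::
  "'a measure \<Rightarrow> nat \<Rightarrow> (nat \<Rightarrow> 'a \<Rightarrow> 'v) \<Rightarrow> ('a \<Rightarrow> 'w) \<Rightarrow> real" where
  "cond_total_corr M m Z W =
     (\<Sum>j=1..m. cond_entropy_bits M (Z j) W) - cond_entropy_bits M (joint m Z) W"

definition total_corr_explained ::
  "'a measure \<Rightarrow> nat \<Rightarrow> (nat \<Rightarrow> 'a \<Rightarrow> 'v) \<Rightarrow> ('a \<Rightarrow> 'w) \<Rightarrow> real" where
  "total_corr_explained M m Z W = total_corr M m Z - cond_total_corr M m Z W"

text \<open>
  \<open>R\<^sub>1, \<dots>, R\<^sub>m\<close> are perfect remainder information for \<open>Z\<^sub>1, \<dots>, Z\<^sub>m\<close> with respect to \<open>Y\<close>.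
  That \<open>Y\<close> is a function of \<open>Z\<close> is not part of this definition.
  The first conjunct is
  \<open>p(z, y, r) = p(z) p(y | z) \<Prod>\<^sub>j p(r\<^sub>j | z\<^sub>j, y)\<close>. The value 0 of \<^const>\<open>cond_prob\<close> for a null
  condition is harmless: if \<open>p(z, y) = 0\<close> then \<open>p(z) p(y | z) = 0\<close>.
\<close>

definition perfect_remainder ::
  "'a measure \<Rightarrow> nat \<Rightarrow> (nat \<Rightarrow> 'a \<Rightarrow> 'v) \<Rightarrow> ('a \<Rightarrow> 'w) \<Rightarrow> (nat \<Rightarrow> 'a \<Rightarrow> 'u) \<Rightarrow> bool" where
  "perfect_remainder M m Z Y R \<longleftrightarrow>
     (\<forall>z y r.
        \<P>(\<omega> in M. (\<forall>j\<in>{1..m}. Z j \<omega> = z j) \<and> Y \<omega> = y \<and> (\<forall>j\<in>{1..m}. R j \<omega> = r j)) =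
        \<P>(\<omega> in M. \<forall>j\<in>{1..m}. Z j \<omega> = z j) *
        \<P>(\<omega> in M. Y \<omega> = y \<bar> \<forall>j\<in>{1..m}. Z j \<omega> = z j) *
        (\<Prod>j=1..m. \<P>(\<omega> in M. R j \<omega> = r j \<bar> Z j \<omega> = z j \<and> Y \<omega> = y))) \<and>
     (\<forall>j\<in>{1..m}. mutual_info_bits M (R j) Y = 0) \<and>
     (\<forall>j\<in>{1..m}. cond_entropy_bits M (Z j) (\<lambda>\<omega>. (R j \<omega>, Y \<omega>)) = 0)"

end

theory Submission
  imports Defs
begin

text \<open>
  For a single layer \<open>X' = (R\<^sub>1, \<dots>, R\<^sub>m, Y)\<close> over \<open>Z\<close>, conditions (i) and (ii) give
  \<open>H(R\<^sub>j) - H(Z\<^sub>j | Y) = H(R\<^sub>j | Z\<^sub>j, Y)\<close> and \<open>H(R | Y) - H(Z | Y) = H(R | Z, Y)\<close>, and the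
  factorization gives \<open>H(R | Z, Y) = \<Sum>\<^sub>j H(R\<^sub>j | Z\<^sub>j, Y)\<close>. Hence \<open>TC(X') = TC(Z | Y)\<close>, and the sum
  over the layers telescopes. All entropies are handled as expectations of the logarithm
  of the probability of a fibre, so that identities between them follow from almost sure
  identities between probabilities.
\<close>

section \<open>Fibre probabilities and joint tuples\<close>

text \<open>This is p(X) evaluated at the outcome, as a real random variable on
  \<open>space M\<close>. It depends only on the partition that \<open>X\<close> induces, so
  variables with different value types can be compared pointwise.\<close>

definition fibre_prob :: "'a measure \<Rightarrow> ('a \<Rightarrow> 'b) \<Rightarrow> 'a \<Rightarrow> real" where
  "fibre_prob M X \<omega> = measure M {\<omega>'\<in>space M. X \<omega>' = X \<omega>}"

lemma fibre_prob_cong: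
  assumes "\<And>\<omega>'. \<omega>' \<in> space M \<Longrightarrow> X \<omega>' = X \<omega> \<longleftrightarrow> X' \<omega>' = X' \<omega>"
  shows "fibre_prob M X \<omega> = fibre_prob M X' \<omega>"
  unfolding fibre_prob_def using assms by (metis (mono_tags, lifting))

lemma simple_function_fibre:
  assumes "simple_function M X"
  shows "{\<omega>'\<in>space M. X \<omega>' = x} \<in> sets M"
  using simple_functionD(2)[OF assms, of "{x}"]
  by (simp add: vimage_def Int_def conj_commute)

lemma simple_function_fibre_prob:
  assumes "simple_function M X"
  shows "simple_function M (fibre_prob M X)"
  unfolding fibre_prob_def[abs_def]
  by (rule simple_function_compose1[OF assms])

lemma joint_eq_iff: "joint m Z \<omega>' = joint m Z \<omega> \<longleftrightarrow> (\<forall>j\<in>{1..m}. Z j \<omega>' = Z j \<omega>)"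
  unfolding joint_def by (auto simp: fun_eq_iff restrict_def)

lemma simple_function_joint:
  assumes "\<And>j. j \<in> {1..m} \<Longrightarrow> simple_function M (Z j)"
  shows "simple_function M (joint m Z)"
  using assms
proof (induction m)
  case 0
  then show ?case by (simp add: joint_def[abs_def])
next
  case (Suc m)
  have "simple_function M (\<lambda>\<omega>. (joint m Z \<omega>)(Suc m := Z (Suc m) \<omega>))"
    using Suc by (intro simple_function_compose2[where h = "\<lambda>f x. f(Suc m := x)"]) auto
  also have "(\<lambda>\<omega>. (joint m Z \<omega>)(Suc m := Z (Suc m) \<omega>)) = joint (Suc m) Z"
    by (auto simp: joint_def fun_eq_iff restrict_def)
  finally show ?case .
qed

section \<open>Entropies as expectations of log fibre probabilities\<close>

context prob_space
begin

lemma integrable_simple_function_real: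
  fixes f :: "'a \<Rightarrow> real"
  assumes "simple_function M f"
  shows "integrable M f"
  by (intro integrable_simple_function assms) (simp add: emeasure_eq_measure)

text \<open>A fibre has probability 0 only over a null value, and there are finitely many values, so
  the bad outcomes form a null set. This licenses division by fibre probabilities and the usual log
  rules almost everywhere.\<close>

lemma AE_fibre_prob_pos:
  assumes X: "simple_function M X"
  shows "AE \<omega> in M. fibre_prob M X \<omega> > 0"
proof -
  let ?N = "\<Union>x\<in>{x \<in> X ` space M. prob {\<omega>\<in>space M. X \<omega> = x} = 0}. {\<omega>\<in>space M. X \<omega> = x}"
  have "?N \<in> null_sets M"
    using simple_functionD(1)[OF X]
    by (intro null_sets.finite_UN)
       (auto intro!: null_setsI simple_function_fibre[OF X] simp: emeasure_eq_measure)
  then show ?thesis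
    by (rule AE_I') (auto simp: fibre_prob_def zero_less_measure_iff)
qed

text \<open>Integrating against the distribution of \<open>X\<close> is transported back to the
  sample space. Entropies of variables with different ranges thereby become integrals over the same
  \<open>M\<close>.\<close>

lemma entropy_bits_eq_expectation:
  assumes X: "simple_function M X"
  shows "entropy_bits M X = - expectation (\<lambda>\<omega>. log 2 (fibre_prob M X \<omega>))"
proof -
  interpret information_space M 2 by unfold_locales simp
  let ?f = "\<lambda>x. prob (X -` {x} \<inter> space M)"
  have D: "distributed M (count_space (X ` space M)) X ?f"
    by (intro simple_distributed simple_distributedI X refl) simp
  have "entropy_bits M X = - (\<integral>x. ?f x * log 2 (?f x) \<partial>count_space (X ` space M))"
    unfolding entropy_bits_def using D by (rule entropy_distr) simp
  also have "\<dots> = - expectation (\<lambda>\<omega>. log 2 (?f (X \<omega>)))"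
    by (subst distributed_integral[OF D]) auto
  also have "(\<lambda>\<omega>. ?f (X \<omega>)) = fibre_prob M X"
    by (auto simp: fibre_prob_def fun_eq_iff vimage_def Int_def conj_commute)
  then have "(\<lambda>\<omega>. log 2 (?f (X \<omega>))) = (\<lambda>\<omega>. log 2 (fibre_prob M X \<omega>))"
    by metis
  finally show ?thesis .
qed

lemma integrable_log_fibre_prob:
  assumes "simple_function M X"
  shows "integrable M (\<lambda>\<omega>. log 2 (fibre_prob M X \<omega>))"
  by (intro integrable_simple_function_real simple_function_compose1[where g = "log 2"]
      simple_function_fibre_prob assms)

lemma entropy_bits_cong_AE:
  assumes "simple_function M X" "simple_function M X'"
    and "AE \<omega> in M. fibre_prob M X \<omega> = fibre_prob M X' \<omega>"
  shows "entropy_bits M X = entropy_bits M X'"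
proof -
  note integrable_log_fibre_prob[OF assms(1), THEN borel_measurable_integrable, measurable]
    integrable_log_fibre_prob[OF assms(2), THEN borel_measurable_integrable, measurable]
  show ?thesis
    unfolding entropy_bits_eq_expectation[OF assms(1)] entropy_bits_eq_expectation[OF assms(2)]
    using assms(3) by (intro arg_cong[where f = uminus] integral_cong_AE) auto
qed

text \<open>Serves to reorder pairs and to trade a tuple ending in \<open>Y\<close> for a pair: both
  sides induce the same partition of the space.\<close>

lemma entropy_bits_cong:
  assumes "simple_function M X" "simple_function M X'"
    and "\<And>\<omega> \<omega>'. \<omega> \<in> space M \<Longrightarrow> \<omega>' \<in> space M \<Longrightarrow> X \<omega>' = X \<omega> \<longleftrightarrow> X' \<omega>' = X' \<omega>"
  shows "entropy_bits M X = entropy_bits M X'"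
  using assms by (intro entropy_bits_cong_AE AE_I2 fibre_prob_cong) auto

lemma cond_entropy_bits_eq:
  assumes X: "simple_function M X" and Y: "simple_function M Y"
  shows "cond_entropy_bits M X Y = entropy_bits M (\<lambda>\<omega>. (X \<omega>, Y \<omega>)) - entropy_bits M Y"
proof -
  interpret information_space M 2 by unfold_locales simp
  have "entropy_bits M (\<lambda>\<omega>. (X \<omega>, Y \<omega>)) = entropy_bits M (\<lambda>\<omega>. (Y \<omega>, X \<omega>))"
    using X Y by (intro entropy_bits_cong) auto
  then show ?thesis
    using entropy_chain_rule[OF Y X] by (simp add: entropy_bits_def cond_entropy_bits_def)
qed

lemma mutual_info_bits_eq:
  assumes X: "simple_function M X" and Y: "simple_function M Y"
  shows "mutual_info_bits M X Y =
    entropy_bits M X + entropy_bits M Y - entropy_bits M (\<lambda>\<omega>. (X \<omega>, Y \<omega>))"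
proof -
  interpret information_space M 2 by unfold_locales simp
  show ?thesis
    using mutual_information_eq_entropy_conditional_entropy[OF X Y] cond_entropy_bits_eq[OF X Y]
    by (simp add: entropy_bits_def cond_entropy_bits_def mutual_info_bits_def)
qed

text \<open>The conditional entropy is the expectation of log p(Y) - log p(X,Y). This is almost
  surely nonnegative, since a fibre of the pair lies inside a fibre of \<open>Y\<close>, so a zero
  expectation forces it to vanish almost surely.\<close>

lemma cond_entropy_bits_eq_0_imp_AE:
  assumes X: "simple_function M X" and Y: "simple_function M Y"
    and "cond_entropy_bits M X Y = 0"
  shows "AE \<omega> in M. fibre_prob M Y \<omega> = fibre_prob M (\<lambda>\<omega>. (X \<omega>, Y \<omega>)) \<omega>"
proof -
  let ?XY = "\<lambda>\<omega>. (X \<omega>, Y \<omega>)"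
  have XY: "simple_function M ?XY" using X Y by simp
  let ?d = "\<lambda>\<omega>. log 2 (fibre_prob M Y \<omega>) - log 2 (fibre_prob M ?XY \<omega>)"
  have le: "fibre_prob M ?XY \<omega> \<le> fibre_prob M Y \<omega>" for \<omega>
    unfolding fibre_prob_def by (intro finite_measure_mono simple_function_fibre[OF Y]) auto
  have "expectation ?d = 0"
    using assms(3) integrable_log_fibre_prob[OF Y] integrable_log_fibre_prob[OF XY]
    by (simp add: cond_entropy_bits_eq[OF X Y] entropy_bits_eq_expectation[OF Y]
        entropy_bits_eq_expectation[OF XY])
  moreover have "integrable M ?d"
    by (intro Bochner_Integration.integrable_diff integrable_log_fibre_prob X Y XY)
  moreover have "AE \<omega> in M. 0 \<le> ?d \<omega>"
    using AE_fibre_prob_pos[OF XY]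
  proof eventually_elim
    case (elim \<omega>)
    then show ?case using le[of \<omega>] by simp
  qed
  ultimately have "AE \<omega> in M. ?d \<omega> = 0"
    using integral_nonneg_eq_0_iff_AE by blast
  then show ?thesis
    using AE_fibre_prob_pos[OF XY]
  proof eventually_elim
    case (elim \<omega>)
    then show ?case using le[of \<omega>] by (simp add: log_def)
  qed
qed

section \<open>A single layer of remainders\<close>

text \<open>The left-hand side is the total correlation of (R_1, ..., R_m, Y): the marginal entropy
  of \<open>Y\<close> turns H(R,Y) into H(R | Y).\<close>

lemma perfect_remainder_total_corr:
  assumes Z: "\<And>j. j \<in> {1..m} \<Longrightarrow> simple_function M (Z j)"
    and R: "\<And>j. j \<in> {1..m} \<Longrightarrow> simple_function M (R j)"
    and Y: "simple_function M Y"
    and rem: "perfect_remainder M m Z Y R"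
  shows "(\<Sum>j=1..m. entropy_bits M (R j)) - cond_entropy_bits M (joint m R) Y =
    cond_total_corr M m Z Y"
proof -
  have JZ: "simple_function M (joint m Z)" and JR: "simple_function M (joint m R)"
    using Z R by (auto intro: simple_function_joint)
  let ?ZY = "\<lambda>\<omega>. (joint m Z \<omega>, Y \<omega>)"
  let ?RY = "\<lambda>\<omega>. (joint m R \<omega>, Y \<omega>)"
  let ?ZRY = "\<lambda>\<omega>. (joint m Z \<omega>, joint m R \<omega>, Y \<omega>)"
  let ?zy = "\<lambda>j \<omega>. (Z j \<omega>, Y \<omega>)"
  let ?ry = "\<lambda>j \<omega>. (R j \<omega>, Y \<omega>)"
  let ?zry = "\<lambda>j \<omega>. (Z j \<omega>, R j \<omega>, Y \<omega>)"
  have sZY: "simple_function M ?ZY" and sRY: "simple_function M ?RY"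
    and sZRY: "simple_function M ?ZRY"
    using JZ JR Y by simp_all
  have szy: "simple_function M (?zy j)" and sry: "simple_function M (?ry j)"
    and szry: "simple_function M (?zry j)" if "j \<in> {1..m}" for j
    using Z[OF that] R[OF that] Y by simp_all

  have null: "AE \<omega> in M. \<forall>j\<in>{1..m}. fibre_prob M (?ry j) \<omega> = fibre_prob M (?zry j) \<omega>"
    using rem Z sry unfolding perfect_remainder_def
    by (intro AE_finite_allI cond_entropy_bits_eq_0_imp_AE) auto
  \<comment> \<open>Condition (ii) gives H(Z_j,R_j,Y) = H(R_j,Y), and condition (i) splits the
    latter.\<close>
  have zry: "entropy_bits M (?zry j) = entropy_bits M (R j) + entropy_bits M Y"
    if j: "j \<in> {1..m}" for j
    using rem j cond_entropy_bits_eq[OF Z[OF j] sry[OF j]] mutual_info_bits_eq[OF R[OF j] Y]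
    by (auto simp: perfect_remainder_def)

  \<comment> \<open>Each Z_j is almost surely determined by (R_j, Y), so adjoining all of Z to (R,
    Y) adds no entropy.\<close>
  have "entropy_bits M ?RY = entropy_bits M ?ZRY"
  proof (rule entropy_bits_cong_AE[OF sRY sZRY])
    show "AE \<omega> in M. fibre_prob M ?RY \<omega> = fibre_prob M ?ZRY \<omega>"
      using null
    proof eventually_elim
      case (elim \<omega>)
      let ?F = "\<lambda>X. {\<omega>'\<in>space M. X \<omega>' = X \<omega>}"
      \<comment> \<open>Outcomes agreeing with \<open>\<omega>\<close> in (R_j, Y) but not in Z_j.
        Each such set is null by \<open>null\<close>, and an outcome agreeing in (R, Y) but not in Z
        lies in one of them.\<close>
      let ?D = "\<lambda>j. ?F (?ry j) - ?F (?zry j)"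
      have "prob (?D j) = 0" if j: "j \<in> {1..m}" for j
        using elim j
        by (subst finite_measure_Diff[OF simple_function_fibre[OF sry[OF j]]
              simple_function_fibre[OF szry[OF j]]]) (auto simp: fibre_prob_def)
      moreover have D: "?D j \<in> sets M" if "j \<in> {1..m}" for j
        using simple_function_fibre[OF sry[OF that]] simple_function_fibre[OF szry[OF that]]
        by (rule sets.Diff)
      ultimately have "(\<Union>j\<in>{1..m}. ?D j) \<in> null_sets M"
        by (intro null_sets.finite_UN null_setsI) (auto simp: emeasure_eq_measure)
      moreover have "?F ?RY - ?F ?ZRY \<subseteq> (\<Union>j\<in>{1..m}. ?D j)"
        by (auto simp: joint_eq_iff)
      moreover have "?F ?RY - ?F ?ZRY \<in> sets M"
        using simple_function_fibre[OF sRY] simple_function_fibre[OF sZRY] by (rule sets.Diff)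
      ultimately have "prob (?F ?RY - ?F ?ZRY) = 0"
        using null_sets_subset measure_eq_0_null_sets by blast
      then show ?case
        by (subst (asm) finite_measure_Diff[OF simple_function_fibre[OF sRY]
              simple_function_fibre[OF sZRY]]) (auto simp: fibre_prob_def)
    qed
  qed

  \<comment> \<open>The expected logarithm of the factorization: H(Z,R,Y) = H(Z,Y) plus the sum of
    the H(R_j | Z_j, Y).\<close>
  moreover have "entropy_bits M ?ZRY =
    entropy_bits M ?ZY + (\<Sum>j=1..m. entropy_bits M (?zry j) - entropy_bits M (?zy j))"
  proof -
    let ?l = "\<lambda>X \<omega>. log 2 (fibre_prob M X \<omega>)"
    let ?rhs = "\<lambda>\<omega>. ?l ?ZY \<omega> + (\<Sum>j=1..m. ?l (?zry j) \<omega> - ?l (?zy j) \<omega>)"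
    have pos: "AE \<omega> in M. \<forall>j\<in>{1..m}. 0 < fibre_prob M (?zry j) \<omega> \<and> 0 < fibre_prob M (?zy j) \<omega>"
      using szry szy by (intro AE_finite_allI AE_conjI AE_fibre_prob_pos) auto
    have "AE \<omega> in M. ?l ?ZRY \<omega> = ?rhs \<omega>"
      using pos AE_fibre_prob_pos[OF sZY] AE_fibre_prob_pos[OF JZ]
    proof eventually_elim
      case (elim \<omega>)
      \<comment> \<open>The factorization is instantiated at the values taken at
        \<open>\<omega>\<close> itself, so that every probability in it becomes a fibre probability
        or a quotient of two.\<close>
      have "fibre_prob M ?ZRY \<omega> = fibre_prob M (joint m Z) \<omega> *
          (fibre_prob M ?ZY \<omega> / fibre_prob M (joint m Z) \<omega>) *
          (\<Prod>j=1..m. fibre_prob M (?zry j) \<omega> / fibre_prob M (?zy j) \<omega>)"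
        using conjunct1[OF rem[unfolded perfect_remainder_def], rule_format,
            of "\<lambda>j. Z j \<omega>" "Y \<omega>" "\<lambda>j. R j \<omega>"]
        by (simp only: fibre_prob_def cond_prob_def prod.inject joint_eq_iff conj_ac)
      also have "\<dots> = fibre_prob M ?ZY \<omega> *
          (\<Prod>j=1..m. fibre_prob M (?zry j) \<omega> / fibre_prob M (?zy j) \<omega>)"
        using elim by simp
      also have "log 2 \<dots> = ?l ?ZY \<omega> +
          (\<Sum>j=1..m. log 2 (fibre_prob M (?zry j) \<omega> / fibre_prob M (?zy j) \<omega>))"
      \<comment> \<open>The logarithm is split through \<open>ln\<close>; positivity of all factors
        is what makes the product rules applicable.\<close>
      proof -
        have q: "0 < fibre_prob M (?zry j) \<omega> / fibre_prob M (?zy j) \<omega>" if "j \<in> {1..m}" for j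
          using elim that by simp
        have "ln (\<Prod>j=1..m. fibre_prob M (?zry j) \<omega> / fibre_prob M (?zy j) \<omega>) =
            (\<Sum>j=1..m. ln (fibre_prob M (?zry j) \<omega> / fibre_prob M (?zy j) \<omega>))"
          by (intro ln_prod less_imp_neq[THEN not_sym] q) auto
        moreover have "0 < (\<Prod>j=1..m. fibre_prob M (?zry j) \<omega> / fibre_prob M (?zy j) \<omega>)"
          using q by (rule prod_pos)
        ultimately show ?thesis
          using elim unfolding log_def
          by (subst ln_mult_pos) (simp_all add: add_divide_distrib sum_divide_distrib)
      qed
      also have "\<dots> = ?rhs \<omega>"
        using elim by (intro arg_cong2[where f = "(+)"] sum.cong refl log_divide_pos) auto
      finally show ?case .
    qed
    moreover have "?l ?ZRY \<in> borel_measurable M" "?rhs \<in> borel_measurable M"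
      using sZRY sZY szry szy
      by (auto intro!: borel_measurable_add borel_measurable_sum borel_measurable_diff
          borel_measurable_integrable[OF integrable_log_fibre_prob])
    ultimately have "expectation (?l ?ZRY) = expectation ?rhs"
      by (intro integral_cong_AE)
    also have "\<dots> = expectation (?l ?ZY) +
        (\<Sum>j=1..m. expectation (?l (?zry j)) - expectation (?l (?zy j)))"
    proof -
      have i: "integrable M (\<lambda>\<omega>. ?l (?zry j) \<omega> - ?l (?zy j) \<omega>)" if "j \<in> {1..m}" for j
        using szry[OF that] szy[OF that]
        by (intro Bochner_Integration.integrable_diff integrable_log_fibre_prob)
      have "expectation (\<lambda>\<omega>. \<Sum>j=1..m. ?l (?zry j) \<omega> - ?l (?zy j) \<omega>) =
          (\<Sum>j=1..m. expectation (\<lambda>\<omega>. ?l (?zry j) \<omega> - ?l (?zy j) \<omega>))"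
        using i by (rule Bochner_Integration.integral_sum)
      also have "\<dots> = (\<Sum>j=1..m. expectation (?l (?zry j)) - expectation (?l (?zy j)))"
        by (intro sum.cong refl Bochner_Integration.integral_diff integrable_log_fibre_prob szry szy)
      finally show ?thesis
        by (subst Bochner_Integration.integral_add)
           (intro integrable_log_fibre_prob sZY Bochner_Integration.integrable_sum i | simp)+
    qed
    finally show ?thesis
      using szry szy
      by (simp add: entropy_bits_eq_expectation[OF sZRY] entropy_bits_eq_expectation[OF sZY]
          entropy_bits_eq_expectation sum_subtractf sum_negf)
  qed

  \<comment> \<open>Inserting \<open>zry\<close>, each summand becomes H(R_j) - (H(Z_j,Y) - H(Y));
    the sum of the H(R_j) cancels and conditional entropies of Z given \<open>Y\<close>
    remain.\<close>
  ultimately show ?thesis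
    using Z Y
    by (simp add: cond_total_corr_def cond_entropy_bits_eq[OF JR Y] cond_entropy_bits_eq[OF JZ Y]
        cond_entropy_bits_eq zry sum_subtractf sum.distrib)
qed

text \<open>Appending \<open>Y\<close> as entry \<open>Suc m\<close> of \<open>R\<close> makes the
  total correlation of the new layer equal to TC(Z | Y), and TC(Z;Y) is by definition what TC(Z) has
  beyond that.\<close>

lemma total_corr_remainder_layer:
  assumes Z: "\<And>j. j \<in> {1..m} \<Longrightarrow> simple_function M (Z j)"
    and R: "\<And>j. j \<in> {1..Suc m} \<Longrightarrow> simple_function M (R j)"
    and rem: "perfect_remainder M m Z Y R"
    and last: "\<And>\<omega>. \<omega> \<in> space M \<Longrightarrow> R (Suc m) \<omega> = Y \<omega>"
  shows "total_corr M m Z = total_corr M (Suc m) R + total_corr_explained M m Z Y"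
proof -
  have Y: "simple_function M Y"
    using R[of "Suc m"] simple_function_cong[of M "R (Suc m)" Y] last by auto
  have R': "simple_function M (R j)" if "j \<in> {1..m}" for j
    using R that by auto
  have JR: "simple_function M (joint m R)" "simple_function M (joint (Suc m) R)"
    using R by (auto intro!: simple_function_joint)
  have "entropy_bits M (R (Suc m)) = entropy_bits M Y"
    using R last by (intro entropy_bits_cong Y) auto
  moreover have "entropy_bits M (joint (Suc m) R) = entropy_bits M (\<lambda>\<omega>. (joint m R \<omega>, Y \<omega>))"
    using JR Y by (intro entropy_bits_cong) (auto simp: joint_eq_iff last atLeastAtMostSuc_conv)
  ultimately have "total_corr M (Suc m) R = cond_total_corr M m Z Y"
    using perfect_remainder_total_corr[OF Z R' Y rem] cond_entropy_bits_eq[OF JR(1) Y]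
    by (simp add: total_corr_def)
  then show ?thesis by (simp add: total_corr_explained_def)
qed

end

section \<open>Telescoping over the layers\<close>

theorem corollary2p4:
  fixes M :: "'a measure"
    and X :: "nat \<Rightarrow> nat \<Rightarrow> 'a \<Rightarrow> 'v"
    and Y :: "nat \<Rightarrow> 'a \<Rightarrow> 'v"
    and n r :: nat
  assumes "prob_space M"
    and "r \<ge> 1"
    and "\<And>k j. k \<le> r \<Longrightarrow> j \<in> {1..n + k} \<Longrightarrow> simple_function M (X k j)"
    and "\<And>k. k \<in> {1..r} \<Longrightarrow>
           \<exists>f :: (nat \<Rightarrow> 'v) \<Rightarrow> 'v. \<forall>\<omega>\<in>space M. Y k \<omega> = f (joint (n + k - 1) (X (k - 1)) \<omega>)"
    and "\<And>k. k \<in> {1..r} \<Longrightarrow> perfect_remainder M (n + k - 1) (X (k - 1)) (Y k) (X k)"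
    and "\<And>k \<omega>. k \<in> {1..r} \<Longrightarrow> \<omega> \<in> space M \<Longrightarrow> X k (n + k) \<omega> = Y k \<omega>"
  shows "total_corr M n (X 0) =
           total_corr M (n + r) (X r) +
           (\<Sum>k=1..r. total_corr_explained M (n + k - 1) (X (k - 1)) (Y k))"
proof -
  interpret prob_space M by fact
  \<comment> \<open>Induction on the number \<open>s\<close> of layers already peeled off. Layer
    \<open>Suc s\<close> is built from a tuple of length \<open>n + Suc s - 1 = n + s\<close>, and
    its last entry, at index \<open>n + Suc s\<close>, is \<open>Y (Suc s)\<close>.\<close>
  have "total_corr M n (X 0) = total_corr M (n + s) (X s) +
      (\<Sum>k=1..s. total_corr_explained M (n + k - 1) (X (k - 1)) (Y k))" if "s \<le> r" for s
    using that
  proof (induction s)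
    case 0
    then show ?case by simp
  next
    case (Suc s)
    have "total_corr M (n + s) (X s) = total_corr M (Suc (n + s)) (X (Suc s)) +
        total_corr_explained M (n + s) (X s) (Y (Suc s))"
      using Suc.prems assms(3)[of s] assms(3)[of "Suc s"] assms(5)[of "Suc s"] assms(6)[of "Suc s"]
      by (intro total_corr_remainder_layer) auto
    then show ?case using Suc by simp
  qed
  then show ?thesis by blast
qed

end
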